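(* Let $(X,r)$ be a finite non-degenerate set-theoretic solution of the Yang--Baxter equation. If $(X,r)$ is derived-indecomposable, then the structure skew brace $G(X,r)$ has property (BS).
   Context: A set-theoretic solution of the Yang--Baxter equation is a pair $(X,r)$ with $X$ a (non-empty) set and $r:X\times X\to X\times X$ a bijection such that $(r\times\operatorname{id})(\operatorname{id}\times r)(r\times\operatorname{id})=(\operatorname{id}\times r)(r\times\operatorname{id})(\operatorname{id}\times r)$ on $X^3$. Write $r(x,y)=(\sigma_x(y),\tau_y(x))$; $(X,r)$ is non-degenerate if all maps $\sigma_x,\tau_y$ are bijective, and finite if $X$ is finite. $(X,r)$ is decomposable if there is a partition of $X$ into two disjoint non-empty subsets $X_1,X_2$ with $r(X_i\times X_i)\subseteq X_i\times X_i$ for $i=1,2$; otherwise it is indecomposable. The derived solution of a non-degenerate $(X,r)$ is the non-degenerate solution $(X,r')$ with $r'(x,y)=(y,\eta_y(x))$, $\eta_y(x)=\sigma_y\big(\tau_{\sigma_x^{-1}(y)}(x)\big)$. $(X,r)$ is derived-indecomposable if $(X,r')$ is indecomposable. A skew (left) brace is a triple $(B,+,\circ)$ where $(B,+)$ and $(B,\circ)$ are groups such that $a\circ(b+c)=a\circ b-a+a\circ c$ for all $a,b,c\in B$. The two identities coincide and are denoted $0$. Put $\lambda_a(b)=-a+a\circ b$, $a\ast b=-a+a\circ b-b$, and $r_B(a,b)=(\lambda_a(b),\lambda_a(b)^{-1}\circ a\circ b)$. For $x\in B$ let $\operatorname{Fix}^r(x)=\{b\in B: x\ast b=0\}$, $\operatorname{Fix}^l(x)=\{b\in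 B: b\ast x=0\}$, and let $C_x^+$, $C_x^\circ$ be the centralisers of $x$ in $(B,+)$ and $(B,\circ)$. $B$ has property (BS) if there is a positive integer $n$ such that $|(B,+):\operatorname{Fix}^r(x)\cap C_x^+|\le n$ and $|(B,\circ):\operatorname{Fix}^l(x)\cap C_x^\circ|\le n$ for all $x\in B$. The structure skew brace $G(X,r)$ of a non-degenerate solution is the unique skew brace with multiplicative group $\langle X\mid xy=\sigma_x(y)\tau_y(x),\ x,y\in X\rangle$ such that $r_{G(X,r)}(\iota\times\iota)=(\iota\times\iota)r$, where $\iota:X\to G(X,r)$ is the canonical map; its additive group is $\langle X\mid x+\sigma_x(y)=\sigma_x(y)+\sigma_{\sigma_x(y)}(\tau_y(x)),\ x,y\in X\rangle$. *)

theory Defs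
  imports "HOL-Algebra.Coset" "HOL-Algebra.Ring"
begin

section \<open>Set-theoretic solutions of the Yang--Baxter equation\<close>

text \<open>A solution lives on a carrier set \<open>X\<close>; the values of \<open>r\<close> outside \<open>X \<times> X\<close> are irrelevant.
  Triples are nested to the right, so \<open>r \<times> id\<close> needs a reassociation and \<open>id \<times> r\<close> does not.\<close>

definition r_times_id :: "('a \<times> 'a \<Rightarrow> 'a \<times> 'a) \<Rightarrow> 'a \<times> 'a \<times> 'a \<Rightarrow> 'a \<times> 'a \<times> 'a" where
  "r_times_id r = (\<lambda>(x, y, z). (fst (r (x, y)), snd (r (x, y)), z))"

definition id_times_r :: "('a \<times> 'a \<Rightarrow> 'a \<times> 'a) \<Rightarrow> 'a \<times> 'a \<times> 'a \<Rightarrow> 'a \<times> 'a \<times> 'a" where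
  "id_times_r r = (\<lambda>(x, y, z). (x, r (y, z)))"

definition ybe_solution :: "'a set \<Rightarrow> ('a \<times> 'a \<Rightarrow> 'a \<times> 'a) \<Rightarrow> bool" where
  "ybe_solution X r \<longleftrightarrow>
     X \<noteq> {} \<and> bij_betw r (X \<times> X) (X \<times> X) \<and>
     (\<forall>t \<in> X \<times> X \<times> X.
        r_times_id r (id_times_r r (r_times_id r t)) = id_times_r r (r_times_id r (id_times_r r t)))"

definition sol_sigma :: "('a \<times> 'a \<Rightarrow> 'a \<times> 'a) \<Rightarrow> 'a \<Rightarrow> 'a \<Rightarrow> 'a" where
  "sol_sigma r x y = fst (r (x, y))"

definition sol_tau :: "('a \<times> 'a \<Rightarrow> 'a \<times> 'a) \<Rightarrow> 'a \<Rightarrow> 'a \<Rightarrow> 'a" where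
  "sol_tau r y x = snd (r (x, y))"

definition non_degenerate :: "'a set \<Rightarrow> ('a \<times> 'a \<Rightarrow> 'a \<times> 'a) \<Rightarrow> bool" where
  "non_degenerate X r \<longleftrightarrow>
     (\<forall>x\<in>X. bij_betw (sol_sigma r x) X X) \<and> (\<forall>y\<in>X. bij_betw (sol_tau r y) X X)"

definition decomposable :: "'a set \<Rightarrow> ('a \<times> 'a \<Rightarrow> 'a \<times> 'a) \<Rightarrow> bool" where
  "decomposable X r \<longleftrightarrow>
     (\<exists>X1 X2. X1 \<noteq> {} \<and> X2 \<noteq> {} \<and> X1 \<inter> X2 = {} \<and> X1 \<union> X2 = X \<and>
        r ` (X1 \<times> X1) \<subseteq> X1 \<times> X1 \<and> r ` (X2 \<times> X2) \<subseteq> X2 \<times> X2)"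

definition indecomposable :: "'a set \<Rightarrow> ('a \<times> 'a \<Rightarrow> 'a \<times> 'a) \<Rightarrow> bool" where
  "indecomposable X r \<longleftrightarrow> \<not> decomposable X r"

definition derived_eta :: "'a set \<Rightarrow> ('a \<times> 'a \<Rightarrow> 'a \<times> 'a) \<Rightarrow> 'a \<Rightarrow> 'a \<Rightarrow> 'a" where
  "derived_eta X r y x = sol_sigma r y (sol_tau r (inv_into X (sol_sigma r x) y) x)"

definition derived_solution :: "'a set \<Rightarrow> ('a \<times> 'a \<Rightarrow> 'a \<times> 'a) \<Rightarrow> 'a \<times> 'a \<Rightarrow> 'a \<times> 'a" where
  "derived_solution X r = (\<lambda>(x, y). (y, derived_eta X r y x))"

definition derived_indecomposable :: "'a set \<Rightarrow> ('a \<times> 'a \<Rightarrow> 'a \<times> 'a) \<Rightarrow> bool" where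
  "derived_indecomposable X r \<longleftrightarrow> indecomposable X (derived_solution X r)"


section \<open>Skew braces\<close>

text \<open>A skew brace is carried by a record of type \<^typ>\<open>'a ring\<close>: \<open>\<oplus>\<close> is the (not necessarily
  commutative) addition, \<open>\<otimes>\<close> is the circle operation, and \<open>inv\<close> is the inverse for \<open>\<otimes>\<close>.
  The equality \<open>\<zero> = \<one>\<close> is a consequence of the brace identity and is not assumed.\<close>

locale skew_brace =
  fixes B (structure)
  assumes add_group: "group (add_monoid B)"
    and circ_group: "group B"
    and brace_distrib: "\<lbrakk> a \<in> carrier B; b \<in> carrier B; c \<in> carrier B \<rbrakk>
      \<Longrightarrow> a \<otimes> (b \<oplus> c) = ((a \<otimes> b) \<ominus> a) \<oplus> (a \<otimes> c)"

definition brace_lambda :: "('a, 'm) ring_scheme \<Rightarrow> 'a \<Rightarrow> 'a \<Rightarrow> 'a" where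
  "brace_lambda B a b = (\<ominus>\<^bsub>B\<^esub> a) \<oplus>\<^bsub>B\<^esub> (a \<otimes>\<^bsub>B\<^esub> b)"

definition brace_star :: "('a, 'm) ring_scheme \<Rightarrow> 'a \<Rightarrow> 'a \<Rightarrow> 'a" where
  "brace_star B a b = ((\<ominus>\<^bsub>B\<^esub> a) \<oplus>\<^bsub>B\<^esub> (a \<otimes>\<^bsub>B\<^esub> b)) \<ominus>\<^bsub>B\<^esub> b"

definition brace_r :: "('a, 'm) ring_scheme \<Rightarrow> 'a \<times> 'a \<Rightarrow> 'a \<times> 'a" where
  "brace_r B = (\<lambda>(a, b).
     (brace_lambda B a b, (inv\<^bsub>B\<^esub> (brace_lambda B a b)) \<otimes>\<^bsub>B\<^esub> a \<otimes>\<^bsub>B\<^esub> b))"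

definition fix_right :: "('a, 'm) ring_scheme \<Rightarrow> 'a \<Rightarrow> 'a set" where
  "fix_right B x = {b \<in> carrier B. brace_star B x b = \<zero>\<^bsub>B\<^esub>}"

definition fix_left :: "('a, 'm) ring_scheme \<Rightarrow> 'a \<Rightarrow> 'a set" where
  "fix_left B x = {b \<in> carrier B. brace_star B b x = \<zero>\<^bsub>B\<^esub>}"

definition centraliser :: "('a, 'm) monoid_scheme \<Rightarrow> 'a \<Rightarrow> 'a set" where
  "centraliser G x = {b \<in> carrier G. x \<otimes>\<^bsub>G\<^esub> b = b \<otimes>\<^bsub>G\<^esub> x}"

text \<open>Finiteness is required separately because \<^const>\<open>card\<close> of an infinite set is \<open>0\<close>.\<close>

definition index_at_most :: "('a, 'm) monoid_scheme \<Rightarrow> 'a set \<Rightarrow> nat \<Rightarrow> bool" where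
  "index_at_most G H n \<longleftrightarrow> finite (rcosets\<^bsub>G\<^esub> H) \<and> card (rcosets\<^bsub>G\<^esub> H) \<le> n"

definition property_BS :: "('a, 'm) ring_scheme \<Rightarrow> bool" where
  "property_BS B \<longleftrightarrow>
     (\<exists>n::nat. n > 0 \<and> (\<forall>x \<in> carrier B.
        index_at_most (add_monoid B) (fix_right B x \<inter> centraliser (add_monoid B) x) n \<and>
        index_at_most B (fix_left B x \<inter> centraliser B x) n))"


section \<open>Groups given by generators and relations\<close>

text \<open>Words in the generators and their formal inverses: \<open>(x, True)\<close> stands for \<open>x\<close> and
  \<open>(x, False)\<close> for its inverse.\<close>

type_synonym 'a word = "('a \<times> bool) list"

abbreviation words :: "'a set \<Rightarrow> 'a word set" where
  "words X \<equiv> lists (X \<times> UNIV)"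

text \<open>A relator set \<open>R\<close> consists of pairs \<open>(u, v)\<close>, each standing for the relation \<open>u = v\<close>.\<close>

inductive word_eq :: "'a set \<Rightarrow> ('a word \<times> 'a word) set \<Rightarrow> 'a word \<Rightarrow> 'a word \<Rightarrow> bool"
  for X R where
  refl: "w \<in> words X \<Longrightarrow> word_eq X R w w"
| sym: "word_eq X R u v \<Longrightarrow> word_eq X R v u"
| trans: "word_eq X R u v \<Longrightarrow> word_eq X R v w \<Longrightarrow> word_eq X R u w"
| cancel: "p \<in> words X \<Longrightarrow> q \<in> words X \<Longrightarrow> x \<in> X
    \<Longrightarrow> word_eq X R (p @ [(x, b), (x, \<not> b)] @ q) (p @ q)"
| relation: "p \<in> words X \<Longrightarrow> q \<in> words X \<Longrightarrow> (u, v) \<in> R \<Longrightarrow> u \<in> words X \<Longrightarrow> v \<in> words X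
    \<Longrightarrow> word_eq X R (p @ u @ q) (p @ v @ q)"

definition word_rel :: "'a set \<Rightarrow> ('a word \<times> 'a word) set \<Rightarrow> ('a word \<times> 'a word) set" where
  "word_rel X R = {(u, v). word_eq X R u v}"

definition presented_group :: "'a set \<Rightarrow> ('a word \<times> 'a word) set \<Rightarrow> 'a word set monoid" where
  "presented_group X R =
     \<lparr> carrier = words X // word_rel X R,
       mult = (\<lambda>A B. \<Union>u\<in>A. \<Union>v\<in>B. word_rel X R `` {u @ v}),
       one = word_rel X R `` {[]} \<rparr>"

lemma word_eq_words:
  assumes "word_eq X R u v"
  shows "u \<in> words X \<and> v \<in> words X"
  using assms by induction auto

lemma equiv_word_rel: "equiv (words X) (word_rel X R)"
proof (rule equivI)
  show "word_rel X R \<subseteq> words X \<times> words X"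
    unfolding word_rel_def using word_eq_words by blast
  show "refl_on (words X) (word_rel X R)"
    unfolding word_rel_def refl_on_def using word_eq.refl by blast
  show "sym (word_rel X R)"
    unfolding word_rel_def sym_def using word_eq.sym by blast
  show "trans (word_rel X R)"
    unfolding word_rel_def trans_def using word_eq.trans by blast
qed

lemma word_eq_append_left:
  assumes "word_eq X R u v" "w \<in> words X"
  shows "word_eq X R (w @ u) (w @ v)"
  using assms
proof induction
  case (refl v)
  then show ?case by (intro word_eq.refl) auto
next
  case (sym u v)
  then show ?case by (blast intro: word_eq.sym)
next
  case (trans u v v')
  then show ?case by (blast intro: word_eq.trans)
next
  case (cancel p q x b)
  then show ?case using word_eq.cancel[of "w @ p" X q x R b] by simp
next
  case (relation p q u v)
  then show ?case using word_eq.relation[of "w @ p" X q u v R] by simp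
qed

lemma word_eq_append_right:
  assumes "word_eq X R u v" "w \<in> words X"
  shows "word_eq X R (u @ w) (v @ w)"
  using assms
proof induction
  case (refl v)
  then show ?case by (intro word_eq.refl) auto
next
  case (sym u v)
  then show ?case by (blast intro: word_eq.sym)
next
  case (trans u v v')
  then show ?case by (blast intro: word_eq.trans)
next
  case (cancel p q x b)
  then show ?case using word_eq.cancel[of p X "q @ w" x R b] by simp
next
  case (relation p q u v)
  then show ?case using word_eq.relation[of p X "q @ w" u v R] by simp
qed

lemma word_eq_append:
  assumes "word_eq X R u u'" "word_eq X R v v'"
  shows "word_eq X R (u @ v) (u' @ v')"
proof (rule word_eq.trans)
  show "word_eq X R (u @ v) (u' @ v)"
    using assms word_eq_words[OF assms(2)] by (intro word_eq_append_right) auto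
  show "word_eq X R (u' @ v) (u' @ v')"
    using assms word_eq_words[OF assms(1)] by (intro word_eq_append_left) auto
qed

lemma presented_group_mult:
  assumes "u \<in> words X" "v \<in> words X"
  shows "word_rel X R `` {u} \<otimes>\<^bsub>presented_group X R\<^esub> word_rel X R `` {v} = word_rel X R `` {u @ v}"
proof -
  have eq: "word_rel X R `` {u' @ v'} = word_rel X R `` {u @ v}"
    if "u' \<in> word_rel X R `` {u}" "v' \<in> word_rel X R `` {v}" for u' v'
  proof -
    have "word_eq X R u u'" "word_eq X R v v'" using that by (simp_all add: word_rel_def)
    then have "(u @ v, u' @ v') \<in> word_rel X R"
      unfolding word_rel_def using word_eq_append by blast
    then show ?thesis by (rule equiv_class_eq[OF equiv_word_rel, symmetric])
  qed
  have u: "u \<in> word_rel X R `` {u}" and v: "v \<in> word_rel X R `` {v}"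
    by (rule equiv_class_self[OF equiv_word_rel assms(1)], rule equiv_class_self[OF equiv_word_rel assms(2)])
  have "(\<Union>u'\<in>word_rel X R `` {u}. \<Union>v'\<in>word_rel X R `` {v}. word_rel X R `` {u' @ v'})
      = (\<Union>u'\<in>word_rel X R `` {u}. \<Union>v'\<in>word_rel X R `` {v}. word_rel X R `` {u @ v})"
    by (intro SUP_cong HOL.refl eq)
  also have "\<dots> = word_rel X R `` {u @ v}"
    using u v by blast
  finally show ?thesis
    by (simp add: presented_group_def)
qed

lemma word_inverse_exists:
  assumes "w \<in> words X"
  shows "\<exists>w' \<in> words X. word_eq X R (w' @ w) []"
  using assms
proof (induction w rule: rev_induct)
  case Nil
  then show ?case by (auto intro!: bexI[of _ "[]"] word_eq.refl)
next
  case (snoc a w)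
  obtain x b where a: "a = (x, b)" by (cases a)
  have x: "x \<in> X" and w: "w \<in> words X" using snoc.prems a by auto
  obtain w' where w': "w' \<in> words X" "word_eq X R (w' @ w) []" using snoc.IH w by auto
  have "word_eq X R ([(x, \<not> b)] @ (w' @ w) @ [(x, b)]) ([(x, \<not> b)] @ [] @ [(x, b)])"
    using w' x by (intro word_eq_append_left word_eq_append_right) auto
  moreover have "word_eq X R ([(x, \<not> b)] @ [] @ [(x, b)]) []"
    using word_eq.cancel[of "[]" X "[]" x R "\<not> b"] x by simp
  ultimately have "word_eq X R (((x, \<not> b) # w') @ (w @ [a])) []"
    unfolding a by (auto intro: word_eq.trans)
  then show ?case using w' x by (intro bexI[of _ "(x, \<not> b) # w'"]) auto
qed

lemma group_presented_group: "group (presented_group X R)"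
proof (rule groupI)
  let ?G = "presented_group X R" and ?c = "\<lambda>w. word_rel X R `` {w}"
  have car: "carrier ?G = ?c ` words X" and one: "\<one>\<^bsub>?G\<^esub> = ?c []"
    by (auto simp: presented_group_def quotient_def)
  have mult: "?c u \<otimes>\<^bsub>?G\<^esub> ?c v = ?c (u @ v)" if "u \<in> words X" "v \<in> words X" for u v
    using that by (rule presented_group_mult)
  have app: "u @ v \<in> words X" if "u \<in> words X" "v \<in> words X" for u v
    using that by simp
  have elim: "\<exists>w. w \<in> words X \<and> x = ?c w" if "x \<in> carrier ?G" for x
    using that unfolding car by blast
  have nil: "[] \<in> words X" by simp
  show "\<one>\<^bsub>?G\<^esub> \<in> carrier ?G" unfolding car one using nil by (rule imageI)
  show "x \<otimes>\<^bsub>?G\<^esub> y \<in> carrier ?G" if x: "x \<in> carrier ?G" and y: "y \<in> carrier ?G" for x y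
  proof -
    obtain u where u: "u \<in> words X" "x = ?c u" using elim[OF x] by blast
    obtain v where v: "v \<in> words X" "y = ?c v" using elim[OF y] by blast
    show ?thesis
      unfolding u(2) v(2) mult[OF u(1) v(1)] car using app[OF u(1) v(1)] by (rule imageI)
  qed
  show "x \<otimes>\<^bsub>?G\<^esub> y \<otimes>\<^bsub>?G\<^esub> z = x \<otimes>\<^bsub>?G\<^esub> (y \<otimes>\<^bsub>?G\<^esub> z)"
    if x: "x \<in> carrier ?G" and y: "y \<in> carrier ?G" and z: "z \<in> carrier ?G" for x y z
  proof -
    obtain u where u: "u \<in> words X" "x = ?c u" using elim[OF x] by blast
    obtain v where v: "v \<in> words X" "y = ?c v" using elim[OF y] by blast
    obtain w where w: "w \<in> words X" "z = ?c w" using elim[OF z] by blast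
    show ?thesis
      unfolding u(2) v(2) w(2) mult[OF u(1) v(1)] mult[OF v(1) w(1)]
        mult[OF app[OF u(1) v(1)] w(1)] mult[OF u(1) app[OF v(1) w(1)]] append_assoc
      by (rule HOL.refl)
  qed
  show "\<one>\<^bsub>?G\<^esub> \<otimes>\<^bsub>?G\<^esub> x = x" if x: "x \<in> carrier ?G" for x
  proof -
    obtain w where w: "w \<in> words X" "x = ?c w" using elim[OF x] by blast
    show ?thesis unfolding w(2) one mult[OF nil w(1)] append_Nil by (rule HOL.refl)
  qed
  show "\<exists>y\<in>carrier ?G. y \<otimes>\<^bsub>?G\<^esub> x = \<one>\<^bsub>?G\<^esub>" if x: "x \<in> carrier ?G" for x
  proof -
    obtain w where w: "w \<in> words X" "x = ?c w" using elim[OF x] by blast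
    obtain w' where w': "w' \<in> words X" "word_eq X R (w' @ w) []"
      using word_inverse_exists[OF w(1)] by blast
    have eq: "?c (w' @ w) = ?c []"
      using w'(2) by (intro equiv_class_eq[OF equiv_word_rel]) (simp add: word_rel_def)
    show ?thesis
    proof
      show "?c w' \<in> carrier ?G" unfolding car using w'(1) by (rule imageI)
      show "?c w' \<otimes>\<^bsub>?G\<^esub> x = \<one>\<^bsub>?G\<^esub>" unfolding w(2) mult[OF w'(1) w(1)] eq one by (rule HOL.refl)
    qed
  qed
qed


section \<open>The structure skew brace of a solution\<close>

definition structure_relations :: "'a set \<Rightarrow> ('a \<times> 'a \<Rightarrow> 'a \<times> 'a) \<Rightarrow> ('a word \<times> 'a word) set" where
  "structure_relations X r =
     {([(x, True), (y, True)], [(sol_sigma r x y, True), (sol_tau r y x, True)])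
       | x y. x \<in> X \<and> y \<in> X}"

definition structure_group :: "'a set \<Rightarrow> ('a \<times> 'a \<Rightarrow> 'a \<times> 'a) \<Rightarrow> 'a word set monoid" where
  "structure_group X r = presented_group X (structure_relations X r)"

definition structure_iota :: "'a set \<Rightarrow> ('a \<times> 'a \<Rightarrow> 'a \<times> 'a) \<Rightarrow> 'a \<Rightarrow> 'a word set" where
  "structure_iota X r x = word_rel X (structure_relations X r) `` {[(x, True)]}"

text \<open>\<open>G\<close> is the structure skew brace of \<open>(X, r)\<close>: its multiplicative group is the structure group
  (\<^const>\<open>monoid.truncate\<close> forgets the additive fields), and the canonical map intertwines \<open>r\<close> with
  the solution of \<open>G\<close>. These conditions determine \<open>\<oplus>\<close> uniquely on the carrier.\<close>

definition is_structure_skew_brace ::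
    "'a set \<Rightarrow> ('a \<times> 'a \<Rightarrow> 'a \<times> 'a) \<Rightarrow> 'a word set ring \<Rightarrow> bool" where
  "is_structure_skew_brace X r G \<longleftrightarrow>
     skew_brace G \<and> monoid.truncate G = structure_group X r \<and>
     (\<forall>x\<in>X. \<forall>y\<in>X.
        brace_r G (structure_iota X r x, structure_iota X r y) =
        map_prod (structure_iota X r) (structure_iota X r) (r (x, y)))"

end

theory Submission
  imports Defs "HOL-Algebra.Generated_Groups"
begin

text \<open>Let \<open>Y\<close> be the image of \<open>X\<close> in \<open>G\<close>. The maps \<open>\<lambda>\<^sub>g\<close> permute \<open>Y\<close>, because each generator
  \<open>x\<close> acts on \<open>Y\<close> through \<open>\<sigma>\<^sub>x\<close>; it follows that \<open>Y\<close> generates the additive group as well. In the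
  additive group, conjugation by \<open>y\<close> acts on \<open>Y\<close> through \<open>\<eta>\<^sub>y\<close>, so a conjugacy class
  properly contained in \<open>Y\<close> and its complement in \<open>Y\<close> would pull back to a decomposition of the
  derived solution. Hence \<open>Y\<close> is a single additive conjugacy class.

  The annihilator of \<open>G\<close> consists of the additively central elements \<open>d\<close> with \<open>\<lambda>\<^sub>d = id\<close> that all
  \<open>\<lambda>\<^sub>x\<close> fix. On it addition and multiplication by \<open>d\<close> agree, and it lies in
  \<open>Fix\<^sup>r(x) \<inter> C\<^sub>x\<^sup>+\<close> and in \<open>Fix\<^sup>l(x) \<inter> C\<^sub>x\<^sup>\<circ>\<close> for every \<open>x\<close>. So its index in the additive
  group, once finite, bounds both indices in the definition of (BS) uniformly
  (\<open>property_BS_if_annihilator_finite_index\<close>).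

  Finiteness of this index comes in two steps. First, some positive multiple \<open>z = N y\<^sub>0\<close> of an
  element of \<open>Y\<close> lies in the annihilator (\<open>common_multiple_in_annihilator\<close>): the multiples of \<open>y\<^sub>0\<close>
  induce only finitely many pairs of maps on \<open>Y\<close>, by conjugation and by \<open>\<lambda>\<close>, so two of them induce
  the same pair, and the difference \<open>z\<close> is central. As the elements of \<open>Y\<close> are all
  conjugate, \<open>N y = z\<close> for every \<open>y \<in> Y\<close>; this makes \<open>z\<close> invariant under all \<open>\<lambda>\<^sub>g\<close>, and then
  \<open>\<lambda>\<^sub>z = id\<close> follows. Second, modulo the annihilator \<open>G\<close> is generated by the finite
  conjugation-closed set \<open>Y\<close> of elements of finite order, hence finite by Dietzmann's argument
  (\<open>finite_transversal_of_central_subgroup\<close>).\<close>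

section \<open>Groups generated by a finite set closed under conjugation\<close>

context group
begin

lemma inv_cancel_left:
  assumes "x \<in> carrier G" "y \<in> carrier G"
  shows "x \<otimes> (inv x \<otimes> y) = y" "inv x \<otimes> (x \<otimes> y) = y"
  using assms by (simp_all add: m_assoc[symmetric])

lemma commutes_with_mult:
  assumes "x \<in> carrier G" "a \<in> carrier G" "b \<in> carrier G"
    and "x \<otimes> a = a \<otimes> x" "x \<otimes> b = b \<otimes> x"
  shows "x \<otimes> (a \<otimes> b) = a \<otimes> b \<otimes> x"
proof -
  have "x \<otimes> (a \<otimes> b) = a \<otimes> x \<otimes> b" using assms by (simp add: m_assoc[symmetric])
  also have "\<dots> = a \<otimes> b \<otimes> x" using assms by (simp add: m_assoc)
  finally show ?thesis .
qed

lemma commutes_with_inv: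
  assumes "x \<in> carrier G" "a \<in> carrier G" and comm: "x \<otimes> a = a \<otimes> x"
  shows "x \<otimes> inv a = inv a \<otimes> x"
proof -
  have "inv a \<otimes> (a \<otimes> x) \<otimes> inv a = inv a \<otimes> (x \<otimes> a) \<otimes> inv a" by (simp only: comm)
  then show ?thesis using assms(1,2) by (simp add: m_assoc inv_cancel_left)
qed

lemma conjugacy_class_closed:
  assumes x: "x \<in> carrier G" and g: "g \<in> carrier G"
    and c: "c \<in> (\<lambda>g. inv g \<otimes> x \<otimes> g) ` carrier G"
  shows "inv g \<otimes> c \<otimes> g \<in> (\<lambda>g. inv g \<otimes> x \<otimes> g) ` carrier G"
proof -
  from c obtain h where h: "c = inv h \<otimes> x \<otimes> h" "h \<in> carrier G" by (rule imageE)
  have "inv g \<otimes> c \<otimes> g = inv (h \<otimes> g) \<otimes> x \<otimes> (h \<otimes> g)"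
    using h g x by (simp add: inv_mult_group m_assoc)
  then show ?thesis by (rule image_eqI) (rule m_closed[OF h(2) g])
qed

lemma index_at_mostI:
  assumes H: "subgroup H G" and W: "finite W" "W \<subseteq> carrier G"
    and cover: "\<And>g. g \<in> carrier G \<Longrightarrow> \<exists>h\<in>H. \<exists>w\<in>W. g = h \<otimes> w"
  shows "index_at_most G H (card W)"
proof -
  have sub: "rcosets H \<subseteq> (\<lambda>w. H #> w) ` W"
  proof
    fix C assume "C \<in> rcosets H"
    then obtain g where g: "g \<in> carrier G" "C = H #> g" by (auto simp: RCOSETS_def)
    obtain h w where hw: "h \<in> H" "w \<in> W" "g = h \<otimes> w" using cover[OF g(1)] by blast
    have h: "h \<in> carrier G" using subgroup.mem_carrier[OF H hw(1)] .
    have "C = (H #> h) #> w"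
      using coset_mult_assoc[OF subgroup.subset[OF H] h] hw(2) W(2) unfolding g(2) hw(3) by auto
    also have "H #> h = H" using h H hw(1) by (rule coset_join2)
    finally show "C \<in> (\<lambda>w. H #> w) ` W" using hw(2) by blast
  qed
  have "card (rcosets H) \<le> card ((\<lambda>w. H #> w) ` W)" using W sub by (intro card_mono) auto
  also have "\<dots> \<le> card W" using W by (intro card_image_le)
  finally show ?thesis using finite_subset[OF sub] W by (auto simp: index_at_most_def)
qed

lemma commutes_with_generated:
  assumes x: "x \<in> carrier G" and Y: "Y \<subseteq> carrier G"
    and comm: "\<And>y. y \<in> Y \<Longrightarrow> x \<otimes> y = y \<otimes> x" and g: "g \<in> generate G Y"
  shows "x \<otimes> g = g \<otimes> x"
  using g
proof (induction g rule: generate.induct)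
  case one
  then show ?case using x by simp
next
  case (incl h)
  then show ?case by (rule comm)
next
  case (inv h)
  then have h: "h \<in> carrier G" using Y by auto
  then show ?case using commutes_with_inv[OF x h comm[OF inv]] by simp
next
  case (eng g h)
  have "g \<in> carrier G" "h \<in> carrier G" using eng.hyps generate_in_carrier[OF Y] by auto
  then show ?case using eng.IH x by (intro commutes_with_mult)
qed

text \<open>Closure under conjugation by the inverse of an element of \<open>Y\<close> comes from finiteness:
  conjugation is injective, so it permutes \<open>Y\<close>.\<close>

lemma conjugation_closed_under_generated:
  assumes fin: "finite Y" and Y: "Y \<subseteq> carrier G"
    and conj: "\<And>x y. x \<in> Y \<Longrightarrow> y \<in> Y \<Longrightarrow> inv y \<otimes> x \<otimes> y \<in> Y"
    and g: "g \<in> generate G Y" and x: "x \<in> Y"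
  shows "inv g \<otimes> x \<otimes> g \<in> Y"
  using g x
proof (induction g arbitrary: x rule: generate.induct)
  case one
  then show ?case using Y by auto
next
  case (incl h)
  then show ?case using conj by simp
next
  case (inv h)
  then have h: "h \<in> carrier G" using Y by auto
  have inj: "inj_on (\<lambda>x. inv h \<otimes> x \<otimes> h) Y"
    using h Y by (intro inj_onI) (auto simp: subset_iff)
  have "(\<lambda>x. inv h \<otimes> x \<otimes> h) ` Y = Y"
    using inv conj by (intro endo_inj_surj[OF fin _ inj]) auto
  then obtain u where u: "u \<in> Y" "x = inv h \<otimes> u \<otimes> h" using inv(2) by blast
  have "inv (inv h) \<otimes> x \<otimes> inv h = u"
    unfolding u(2) using h u(1) Y by (auto simp: m_assoc inv_cancel_left subset_iff)
  then show ?case using u(1) by simp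
next
  case (eng g h)
  have c: "g \<in> carrier G" "h \<in> carrier G" "x \<in> carrier G"
    using eng.hyps eng.prems Y generate_in_carrier[OF Y] by auto
  have "inv (g \<otimes> h) \<otimes> x \<otimes> (g \<otimes> h) = inv h \<otimes> (inv g \<otimes> x \<otimes> g) \<otimes> h"
    using c by (simp add: inv_mult_group m_assoc)
  then show ?case using eng.IH eng.prems by simp
qed

abbreviation list_product :: "'a list \<Rightarrow> 'a" where
  "list_product ws \<equiv> foldr (\<otimes>) ws \<one>"

lemma list_product_closed: "set ws \<subseteq> carrier G \<Longrightarrow> list_product ws \<in> carrier G"
  by (induction ws) auto

lemma list_product_append:
  "set us \<subseteq> carrier G \<Longrightarrow> set vs \<subseteq> carrier G \<Longrightarrow>
    list_product (us @ vs) = list_product us \<otimes> list_product vs"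
  by (induction us) (auto simp: m_assoc list_product_closed)

lemma list_product_replicate:
  "y \<in> carrier G \<Longrightarrow> list_product (replicate n y) = y [^] n"
proof (induction n)
  case (Suc n)
  then show ?case using nat_pow_Suc2[of y n] by simp
qed simp

lemma list_product_move_left:
  assumes "y \<in> carrier G" "set us \<subseteq> carrier G"
  shows "list_product us \<otimes> y = y \<otimes> list_product (map (\<lambda>x. inv y \<otimes> x \<otimes> y) us)"
  using assms(2)
proof (induction us)
  case Nil
  then show ?case using assms by simp
next
  case (Cons a us)
  let ?us = "map (\<lambda>x. inv y \<otimes> x \<otimes> y) us"
  have c: "a \<in> carrier G" "list_product us \<in> carrier G" "list_product ?us \<in> carrier G"
    using Cons.prems assms by (auto intro!: list_product_closed simp: subset_iff)
  have "list_product (a # us) \<otimes> y = a \<otimes> (y \<otimes> list_product ?us)"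
    using Cons c assms(1) by (simp add: m_assoc)
  also have "\<dots> = y \<otimes> (inv y \<otimes> a \<otimes> y \<otimes> list_product ?us)"
    using c assms(1) by (simp add: m_assoc inv_cancel_left)
  finally show ?case by simp
qed

text \<open>Moving occurrences of \<open>y\<close> to the front only conjugates the letters passed, and these stay in
  \<open>Y\<close>; so the word keeps its length.\<close>

lemma collect_occurrences:
  assumes Y: "Y \<subseteq> carrier G"
    and conj: "\<And>x y. x \<in> Y \<Longrightarrow> y \<in> Y \<Longrightarrow> inv y \<otimes> x \<otimes> y \<in> Y"
    and y: "y \<in> Y" and ws: "set ws \<subseteq> Y" and n: "n \<le> count_list ws y"
  shows "\<exists>vs. set vs \<subseteq> Y \<and> length vs + n = length ws \<and>
    list_product ws = y [^] n \<otimes> list_product vs"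
  using ws n
proof (induction n arbitrary: ws)
  case 0
  then show ?case using Y by (intro exI[of _ ws]) (auto simp: list_product_closed)
next
  case (Suc n)
  have yG: "y \<in> carrier G" using y Y by auto
  have "y \<in> set ws" using Suc.prems(2) by (metis count_list_0_iff not_less_eq_eq zero_le)
  then obtain us bs where split: "ws = us @ y # bs" "y \<notin> set us"
    by (meson split_list_first)
  define cs where "cs = map (\<lambda>x. inv y \<otimes> x \<otimes> y) us"
  have us: "set us \<subseteq> Y" "set bs \<subseteq> Y" using Suc.prems split by auto
  then have cs: "set cs \<subseteq> Y" using conj y by (auto simp: cs_def)
  have "n \<le> count_list (cs @ bs) y" using Suc.prems(2) split by auto
  then obtain vs where vs: "set vs \<subseteq> Y" "length vs + n = length (cs @ bs)"
      "list_product (cs @ bs) = y [^] n \<otimes> list_product vs"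
    using Suc.IH[of "cs @ bs"] cs us by auto
  have G: "set us \<subseteq> carrier G" "set bs \<subseteq> carrier G" "set cs \<subseteq> carrier G" "set vs \<subseteq> carrier G"
    using us cs vs Y by auto
  note c = G[THEN list_product_closed]
  have "list_product ws = (list_product us \<otimes> y) \<otimes> list_product bs"
    using G yG c unfolding split(1)
    by (subst list_product_append) (auto simp: m_assoc)
  also have "\<dots> = y \<otimes> list_product (cs @ bs)"
    using G yG c by (simp add: list_product_move_left[OF yG] cs_def[symmetric] list_product_append m_assoc
        del: foldr_append)
  also have "\<dots> = y [^] Suc n \<otimes> list_product vs"
    unfolding vs(3) nat_pow_Suc2[OF yG] using yG c by (simp add: m_assoc)
  finally show ?case using vs split by (intro exI[of _ vs]) (auto simp: cs_def)
qed

text \<open>This is Dietzmann's lemma relative to a central subgroup: \<open>N\<close>-th powers of generators are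
  absorbed by \<open>K\<close>, so a word with \<open>N\<close> equal letters can be shortened by collecting them, and
  by the pigeonhole principle every word longer than \<open>card Y * N\<close> has such a letter. Hence the
  words of bounded length represent all cosets.\<close>

lemma finite_transversal_of_central_subgroup:
  assumes K: "subgroup K G"
    and central: "\<And>k g. k \<in> K \<Longrightarrow> g \<in> carrier G \<Longrightarrow> k \<otimes> g = g \<otimes> k"
    and fin: "finite Y" and Y: "Y \<subseteq> carrier G"
    and conj: "\<And>x y. x \<in> Y \<Longrightarrow> y \<in> Y \<Longrightarrow> inv y \<otimes> x \<otimes> y \<in> Y"
    and gen: "generate G Y = carrier G"
    and N: "0 < (N::nat)" and pow: "\<And>y. y \<in> Y \<Longrightarrow> y [^] N \<in> K"
  shows "\<exists>W. finite W \<and> W \<subseteq> carrier G \<and> (\<forall>g\<in>carrier G. \<exists>k\<in>K. \<exists>w\<in>W. g = k \<otimes> w)"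
proof -
  have KG: "k \<in> carrier G" if "k \<in> K" for k using subgroup.mem_carrier[OF K that] .
  have lp: "list_product ws \<in> carrier G" if "set ws \<subseteq> Y" for ws
    using that Y by (intro list_product_closed) auto
  have words: "\<exists>k ws. k \<in> K \<and> set ws \<subseteq> Y \<and> g = k \<otimes> list_product ws" if "g \<in> generate G Y" for g
    using that
  proof (induction g rule: generate.induct)
    case one
    show ?case using subgroup.one_closed[OF K] by (intro exI[of _ "\<one>"] exI[of _ "[]"]) auto
  next
    case (incl h)
    then show ?case using Y subgroup.one_closed[OF K]
      by (intro exI[of _ "\<one>"] exI[of _ "[h]"]) auto
  next
    case (inv h)
    then have h: "h \<in> carrier G" using Y by auto
    obtain M where M: "N = Suc M" using N by (cases N) auto
    \<comment> \<open>A formal inverse is a positive word modulo \<open>K\<close>, because \<open>h\<close> has finite order there.\<close>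
    have "inv h = inv (h [^] N) \<otimes> h [^] M"
      using h unfolding M by (simp add: inv_mult_group m_assoc)
    then show ?case using subgroup.m_inv_closed[OF K pow[OF inv]] inv h
      by (intro exI[of _ "inv (h [^] N)"] exI[of _ "replicate M h"])
        (auto simp: list_product_replicate simp del: foldr_replicate)
  next
    case (eng g h)
    obtain k us where u: "k \<in> K" "set us \<subseteq> Y" "g = k \<otimes> list_product us" using eng.IH by blast
    obtain l vs where v: "l \<in> K" "set vs \<subseteq> Y" "h = l \<otimes> list_product vs" using eng.IH by blast
    note c = KG[OF u(1)] KG[OF v(1)] lp[OF u(2)] lp[OF v(2)]
    have "g \<otimes> h = k \<otimes> (list_product us \<otimes> l) \<otimes> list_product vs" using u v c by (simp add: m_assoc)
    also have "list_product us \<otimes> l = l \<otimes> list_product us" using central[OF v(1) c(3)] by simp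
    also have "k \<otimes> (l \<otimes> list_product us) \<otimes> list_product vs = (k \<otimes> l) \<otimes> list_product (us @ vs)"
      using c u v Y by (subst list_product_append) (auto simp: m_assoc)
    finally show ?case using u v subgroup.m_closed[OF K]
      by (intro exI[of _ "k \<otimes> l"] exI[of _ "us @ vs"]) auto
  qed
  have shorten: "\<exists>k vs. k \<in> K \<and> set vs \<subseteq> Y \<and> length vs \<le> card Y * N \<and>
      list_product ws = k \<otimes> list_product vs" if "set ws \<subseteq> Y" for ws
    using that
  proof (induction ws rule: length_induct)
    case (1 ws)
    show ?case
    proof (cases "length ws \<le> card Y * N")
      case True
      then show ?thesis using 1 lp subgroup.one_closed[OF K]
        by (intro exI[of _ "\<one>"] exI[of _ ws]) auto
    next
      case False
      have "\<exists>y\<in>Y. N \<le> count_list ws y"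
      proof (rule ccontr)
        assume "\<not> ?thesis"
        then have "sum (count_list ws) Y \<le> card Y * N"
          using sum_bounded_above[of Y "count_list ws" N] by (simp add: not_le less_imp_le)
        then show False using False sum_count_set[OF _ fin] 1 by simp
      qed
      then obtain y where y: "y \<in> Y" "N \<le> count_list ws y" by blast
      obtain vs where vs: "set vs \<subseteq> Y" "length vs + N = length ws"
          "list_product ws = y [^] N \<otimes> list_product vs"
        using collect_occurrences[OF Y conj y(1) _ y(2)] 1 by blast
      then obtain k us where us: "k \<in> K" "set us \<subseteq> Y" "length us \<le> card Y * N"
          "list_product vs = k \<otimes> list_product us"
        using 1 N by (metis less_add_same_cancel1)
      have "list_product ws = (y [^] N \<otimes> k) \<otimes> list_product us"
        using vs us KG pow[OF y(1)] lp by (simp add: m_assoc)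
      then show ?thesis using us subgroup.m_closed[OF K pow[OF y(1)] us(1)] by blast
    qed
  qed
  let ?W = "list_product ` {ws. set ws \<subseteq> Y \<and> length ws \<le> card Y * N}"
  show ?thesis
  proof (intro exI[of _ ?W] conjI ballI)
    show "finite ?W" using finite_lists_length_le[OF fin] by (rule finite_imageI)
    show "?W \<subseteq> carrier G" using lp by auto
    fix g assume "g \<in> carrier G"
    then obtain k ws where k: "k \<in> K" "set ws \<subseteq> Y" "g = k \<otimes> list_product ws"
      using words gen by blast
    obtain l vs where l: "l \<in> K" "set vs \<subseteq> Y" "length vs \<le> card Y * N"
        "list_product ws = l \<otimes> list_product vs" using shorten[OF k(2)] by blast
    have "g = (k \<otimes> l) \<otimes> list_product vs" using k l KG lp by (simp add: m_assoc)
    then show "\<exists>k\<in>K. \<exists>w\<in>?W. g = k \<otimes> w" using subgroup.m_closed[OF K k(1) l(1)] l by blast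
  qed
qed

end

section \<open>Skew braces and their annihilators\<close>

sublocale skew_brace \<subseteq> group B
  by (rule circ_group)

sublocale skew_brace \<subseteq> add: group "add_monoid B"
  rewrites "carrier (add_monoid B) = carrier B"
    and "mult (add_monoid B) = add B"
    and "one (add_monoid B) = zero B"
    and "m_inv (add_monoid B) = a_inv B"
    and "pow (add_monoid B) = (\<lambda>a k. add_pow B k a)"
  by (rule add_group) (auto simp: a_inv_def add_pow_def)

context skew_brace
begin

definition add_span :: "'a set \<Rightarrow> 'a set" where
  "add_span Y = generate (add_monoid B) Y"

lemma add_span_subset: "Y \<subseteq> carrier B \<Longrightarrow> add_span Y \<subseteq> carrier B"
  unfolding add_span_def by (rule add.generate_incl)

lemma add_span_closed:
  "\<zero> \<in> add_span Y"
  "y \<in> Y \<Longrightarrow> y \<in> add_span Y"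
  "y \<in> Y \<Longrightarrow> \<ominus> y \<in> add_span Y"
  "a \<in> add_span Y \<Longrightarrow> b \<in> add_span Y \<Longrightarrow> a \<oplus> b \<in> add_span Y"
  using generate.one[of "add_monoid B" Y] generate.incl[of y Y "add_monoid B"]
    generate.inv[of y Y "add_monoid B"] generate.eng[of a "add_monoid B" Y b]
  by (simp_all add: a_inv_def add_span_def)

lemma add_span_induct [consumes 1, case_names zero incl neg add]:
  assumes "a \<in> add_span Y" "P \<zero>" "\<And>y. y \<in> Y \<Longrightarrow> P y" "\<And>y. y \<in> Y \<Longrightarrow> P (\<ominus> y)"
    and "\<And>a b. a \<in> add_span Y \<Longrightarrow> b \<in> add_span Y \<Longrightarrow> P a \<Longrightarrow> P b \<Longrightarrow> P (a \<oplus> b)"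
  shows "P a"
  using assms(1) unfolding add_span_def
  by (induction a rule: generate.induct)
    (use assms(2-) in \<open>simp_all add: a_inv_def add_span_def\<close>)

abbreviation lam :: "'a \<Rightarrow> 'a \<Rightarrow> 'a" where
  "lam \<equiv> brace_lambda B"

lemma lam_closed [simp]: "a \<in> carrier B \<Longrightarrow> b \<in> carrier B \<Longrightarrow> lam a b \<in> carrier B"
  by (simp add: brace_lambda_def)

lemma zero_eq_one: "\<zero> = \<one>"
proof -
  have "\<zero> = \<ominus> \<one>" using brace_distrib[of \<one> \<zero> \<zero>] by (simp add: a_minus_def)
  then have "\<ominus> \<zero> = \<ominus> (\<ominus> \<one>)" by (rule arg_cong)
  then show ?thesis by simp
qed

lemma circ_eq_add_lam: "a \<in> carrier B \<Longrightarrow> b \<in> carrier B \<Longrightarrow> a \<otimes> b = a \<oplus> lam a b"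
  by (simp add: brace_lambda_def add.m_assoc[symmetric])

lemma lam_add:
  assumes "a \<in> carrier B" "b \<in> carrier B" "c \<in> carrier B"
  shows "lam a (b \<oplus> c) = lam a b \<oplus> lam a c"
  using assms by (simp add: brace_lambda_def brace_distrib a_minus_def add.m_assoc)

lemma lam_zero: "a \<in> carrier B \<Longrightarrow> lam a \<zero> = \<zero>"
  using r_one[of a] unfolding brace_lambda_def zero_eq_one[symmetric] by simp

lemma lam_neg:
  assumes "a \<in> carrier B" "b \<in> carrier B"
  shows "lam a (\<ominus> b) = \<ominus> lam a b"
proof -
  have "lam a (\<ominus> b) \<oplus> lam a b = \<zero>"
    using assms by (simp add: lam_add[symmetric] lam_zero)
  from add.inv_equality[OF this] show ?thesis using assms by simp
qed

lemma lam_one: "b \<in> carrier B \<Longrightarrow> lam \<one> b = b"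
proof -
  assume b: "b \<in> carrier B"
  have "\<ominus> \<one> = \<zero>" using add.inv_one unfolding zero_eq_one .
  then show ?thesis using b by (simp add: brace_lambda_def)
qed

lemma lam_circ:
  assumes "a \<in> carrier B" "b \<in> carrier B" "c \<in> carrier B"
  shows "lam (a \<otimes> b) c = lam a (lam b c)"
proof -
  have "a \<otimes> b \<oplus> lam (a \<otimes> b) c = a \<otimes> (b \<otimes> c)"
    using assms by (simp add: circ_eq_add_lam[symmetric] m_assoc)
  also have "\<dots> = a \<oplus> lam a (b \<oplus> lam b c)" using assms by (simp add: circ_eq_add_lam)
  also have "\<dots> = a \<otimes> b \<oplus> lam a (lam b c)"
    using assms by (simp add: lam_add circ_eq_add_lam add.m_assoc)
  finally show ?thesis using assms by simp
qed

lemma lam_inv_cancel: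
  assumes "a \<in> carrier B" "b \<in> carrier B"
  shows "lam (inv a) (lam a b) = b" "lam a (lam (inv a) b) = b"
  using assms by (simp_all add: lam_circ[symmetric] lam_one)

lemma lam_pow:
  assumes "a \<in> carrier B" "b \<in> carrier B"
  shows "lam a ([(n::nat)] \<cdot> b) = [n] \<cdot> lam a b"
  using assms by (induction n) (auto simp: lam_zero lam_add)

lemma lam_fixes_generated:
  assumes a: "a \<in> carrier B" and Y: "Y \<subseteq> carrier B"
    and fix_gens: "\<And>y. y \<in> Y \<Longrightarrow> lam a y = y" and g: "g \<in> add_span Y"
  shows "lam a g = g"
  using g
proof (induction g rule: add_span_induct)
  case zero
  then show ?case using a by (simp add: lam_zero)
next
  case (incl h)
  then show ?case by (rule fix_gens)
next
  case (neg h)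
  then show ?case using a Y fix_gens by (auto simp: lam_neg)
next
  case (add g h)
  have "g \<in> carrier B" "h \<in> carrier B" using add.hyps add_span_subset[OF Y] by auto
  then show ?case using add.IH a by (simp add: lam_add)
qed

lemma brace_star_eq_zero_iff:
  assumes "a \<in> carrier B" "b \<in> carrier B"
  shows "brace_star B a b = \<zero> \<longleftrightarrow> lam a b = b"
proof -
  have "brace_star B a b = lam a b \<oplus> \<ominus> b"
    by (simp add: brace_star_def brace_lambda_def a_minus_def)
  moreover have "lam a b \<oplus> \<ominus> b \<oplus> b = lam a b" using assms by (simp add: add.m_assoc)
  ultimately show ?thesis using assms by auto
qed

definition annihilator :: "'a set" where
  "annihilator = {d \<in> carrier B. \<forall>x\<in>carrier B. d \<oplus> x = x \<oplus> d \<and> lam d x = x \<and> lam x d = d}"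

lemma annihilatorD:
  assumes "d \<in> annihilator"
  shows "d \<in> carrier B"
    and "x \<in> carrier B \<Longrightarrow> d \<oplus> x = x \<oplus> d"
    and "x \<in> carrier B \<Longrightarrow> lam d x = x"
    and "x \<in> carrier B \<Longrightarrow> lam x d = d"
  using assms by (auto simp: annihilator_def)

lemma annihilatorI:
  assumes "d \<in> carrier B"
    and "\<And>x. x \<in> carrier B \<Longrightarrow> d \<oplus> x = x \<oplus> d"
    and "\<And>x. x \<in> carrier B \<Longrightarrow> lam d x = x"
    and "\<And>x. x \<in> carrier B \<Longrightarrow> lam x d = d"
  shows "d \<in> annihilator"
  unfolding annihilator_def using assms by blast

lemma annihilator_circ:
  assumes "d \<in> annihilator" "x \<in> carrier B"
  shows "d \<otimes> x = d \<oplus> x" "x \<otimes> d = d \<otimes> x"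
  using circ_eq_add_lam[of d x] circ_eq_add_lam[of x d] annihilatorD(1)[OF assms(1)]
    annihilatorD(2-4)[OF assms] assms(2) by simp_all

lemma annihilator_add_subgroup: "subgroup annihilator (add_monoid B)"
proof (rule add.subgroupI[simplified])
  show "annihilator \<subseteq> carrier B" by (auto simp: annihilator_def)
  have "lam \<zero> x = x" if "x \<in> carrier B" for x using lam_one[OF that] unfolding zero_eq_one .
  then have "\<zero> \<in> annihilator" by (auto simp: annihilator_def lam_zero)
  then show "annihilator \<noteq> {}" by blast
next
  fix d assume d: "d \<in> annihilator"
  note D = annihilatorD[OF d]
  \<comment> \<open>On the annihilator both group structures agree, so the two inverses of \<open>d\<close> agree as well.\<close>
  have "\<ominus> d \<otimes> d = \<zero>" using annihilator_circ(2)[OF d, of "\<ominus> d"] annihilator_circ(1)[OF d, of "\<ominus> d"] D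
    by simp
  then have neg: "\<ominus> d = inv d" using inv_equality[of "\<ominus> d" d] D(1) zero_eq_one by simp
  have "lam (\<ominus> d) x = x" if x: "x \<in> carrier B" for x
    using lam_inv_cancel(1)[OF D(1) x] D(3)[OF x] neg by simp
  moreover have "\<ominus> d \<oplus> x = x \<oplus> \<ominus> d" if x: "x \<in> carrier B" for x
    using add.commutes_with_inv[OF x D(1)] D(2)[OF x] by simp
  moreover have "lam x (\<ominus> d) = \<ominus> d" if "x \<in> carrier B" for x
    unfolding lam_neg[OF that D(1)] D(4)[OF that] ..
  ultimately show "\<ominus> d \<in> annihilator" using D(1) by (intro annihilatorI add.inv_closed)
next
  fix d e assume d: "d \<in> annihilator" and e: "e \<in> annihilator"
  note D = annihilatorD[OF d] and E = annihilatorD[OF e]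
  have "lam (d \<oplus> e) x = x" if x: "x \<in> carrier B" for x
    using annihilator_circ(1)[OF d E(1)] lam_circ[OF D(1) E(1) x] D(3)[OF x] E(3)[OF x] by simp
  moreover have "d \<oplus> e \<oplus> x = x \<oplus> (d \<oplus> e)" if x: "x \<in> carrier B" for x
    using add.commutes_with_mult[OF x D(1) E(1)] D(2)[OF x] E(2)[OF x] by simp
  moreover have "lam x (d \<oplus> e) = d \<oplus> e" if "x \<in> carrier B" for x
    unfolding lam_add[OF that D(1) E(1)] D(4)[OF that] E(4)[OF that] ..
  ultimately show "d \<oplus> e \<in> annihilator" using D(1) E(1) by (intro annihilatorI add.m_closed)
qed

lemma fix_right_centraliser_subgroup:
  assumes x: "x \<in> carrier B"
  shows "subgroup (fix_right B x \<inter> centraliser (add_monoid B) x) (add_monoid B)"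
    (is "subgroup ?H _")
proof -
  have H: "?H = {b \<in> carrier B. lam x b = b \<and> x \<oplus> b = b \<oplus> x}"
    using x by (auto simp: fix_right_def centraliser_def brace_star_eq_zero_iff)
  show ?thesis unfolding H
  proof (rule add.subgroupI[simplified])
    show "{b \<in> carrier B. lam x b = b \<and> x \<oplus> b = b \<oplus> x} \<noteq> {}"
      using x lam_zero[OF x] by force
  next
    fix a assume a: "a \<in> {b \<in> carrier B. lam x b = b \<and> x \<oplus> b = b \<oplus> x}"
    then have "x \<oplus> \<ominus> a = \<ominus> a \<oplus> x"
      using x add.commutes_with_inv by blast
    then show "\<ominus> a \<in> {b \<in> carrier B. lam x b = b \<and> x \<oplus> b = b \<oplus> x}"
      using a x by (auto simp: lam_neg)
  next
    fix a b
    assume a: "a \<in> {b \<in> carrier B. lam x b = b \<and> x \<oplus> b = b \<oplus> x}"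
      and b: "b \<in> {b \<in> carrier B. lam x b = b \<and> x \<oplus> b = b \<oplus> x}"
    then have "x \<oplus> (a \<oplus> b) = a \<oplus> b \<oplus> x"
      using x add.commutes_with_mult by blast
    then show "a \<oplus> b \<in> {b \<in> carrier B. lam x b = b \<and> x \<oplus> b = b \<oplus> x}"
      using a b x by (auto simp: lam_add)
  qed auto
qed

lemma fix_left_centraliser_subgroup:
  assumes x: "x \<in> carrier B"
  shows "subgroup (fix_left B x \<inter> centraliser B x) B"
    (is "subgroup ?H _")
proof -
  have H: "?H = {b \<in> carrier B. lam b x = x \<and> x \<otimes> b = b \<otimes> x}"
    using x by (auto simp: fix_left_def centraliser_def brace_star_eq_zero_iff)
  show ?thesis unfolding H
  proof (rule subgroupI)
    show "{b \<in> carrier B. lam b x = x \<and> x \<otimes> b = b \<otimes> x} \<noteq> {}"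
      using x lam_one[OF x] by force
  next
    fix a assume a: "a \<in> {b \<in> carrier B. lam b x = x \<and> x \<otimes> b = b \<otimes> x}"
    then have "x \<otimes> inv a = inv a \<otimes> x"
      using x commutes_with_inv by blast
    moreover have "lam (inv a) x = x" using a x lam_inv_cancel(1)[of a x] by auto
    ultimately show "inv a \<in> {b \<in> carrier B. lam b x = x \<and> x \<otimes> b = b \<otimes> x}"
      using a by auto
  next
    fix a b
    assume a: "a \<in> {b \<in> carrier B. lam b x = x \<and> x \<otimes> b = b \<otimes> x}"
      and b: "b \<in> {b \<in> carrier B. lam b x = x \<and> x \<otimes> b = b \<otimes> x}"
    then have "x \<otimes> (a \<otimes> b) = a \<otimes> b \<otimes> x"
      using x commutes_with_mult by blast
    then show "a \<otimes> b \<in> {b \<in> carrier B. lam b x = x \<and> x \<otimes> b = b \<otimes> x}"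
      using a b x by (auto simp: lam_circ)
  qed auto
qed

text \<open>Representatives of the additive cosets of the annihilator represent its multiplicative
  cosets too, since \<open>k \<oplus> w = k \<otimes> w\<close> for \<open>k\<close> in the annihilator; so the same set bounds both indices.\<close>

lemma property_BS_if_annihilator_finite_index:
  assumes W: "finite W" "W \<subseteq> carrier B"
    and cover: "\<forall>g\<in>carrier B. \<exists>k\<in>annihilator. \<exists>w\<in>W. g = k \<oplus> w"
  shows "property_BS B"
  unfolding property_BS_def
proof (intro exI[of _ "Suc (card W)"] conjI ballI)
  fix x assume x: "x \<in> carrier B"
  have right: "annihilator \<subseteq> fix_right B x \<inter> centraliser (add_monoid B) x"
    using x annihilatorD(1,4) annihilatorD(2)[symmetric]
    by (simp add: subset_iff fix_right_def centraliser_def brace_star_eq_zero_iff)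
  have left: "annihilator \<subseteq> fix_left B x \<inter> centraliser B x"
    using x annihilatorD(1,3) annihilator_circ(2)
    by (simp add: subset_iff fix_left_def centraliser_def brace_star_eq_zero_iff)
  have "index_at_most (add_monoid B) (fix_right B x \<inter> centraliser (add_monoid B) x) (card W)"
    using cover right by (intro add.index_at_mostI fix_right_centraliser_subgroup x W) blast
  then show "index_at_most (add_monoid B) (fix_right B x \<inter> centraliser (add_monoid B) x) (Suc (card W))"
    by (simp add: index_at_most_def)
  have "\<exists>h\<in>fix_left B x \<inter> centraliser B x. \<exists>w\<in>W. g = h \<otimes> w" if g: "g \<in> carrier B" for g
  proof -
    obtain k w where kw: "k \<in> annihilator" "w \<in> W" "g = k \<oplus> w" using cover g by blast
    then have "g = k \<otimes> w" using annihilator_circ(1)[of k w] W by auto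
    then show ?thesis using kw left by blast
  qed
  then have "index_at_most B (fix_left B x \<inter> centraliser B x) (card W)"
    by (intro index_at_mostI fix_left_centraliser_subgroup x W)
  then show "index_at_most B (fix_left B x \<inter> centraliser B x) (Suc (card W))"
    by (simp add: index_at_most_def)
qed simp

text \<open>The order of the argument matters: that conjugation by \<open>z\<close> is trivial follows directly from
  the coincidence of two multiples of \<open>y0\<close>, whereas triviality of \<open>\<lambda>\<^sub>z\<close> needs that \<open>z\<close> is fixed by
  every \<open>\<lambda>\<^sub>g\<close>, because \<open>\<lambda>\<close> is a homomorphism for \<open>\<otimes>\<close> and not for \<open>\<oplus>\<close>.\<close>

lemma common_multiple_in_annihilator:
  assumes fin: "finite Y" and Y: "Y \<subseteq> carrier B"
    and gen: "add_span Y = carrier B"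
    and lamY: "\<And>g y. g \<in> carrier B \<Longrightarrow> y \<in> Y \<Longrightarrow> lam g y \<in> Y"
    and y0: "y0 \<in> Y" and cls: "Y = (\<lambda>g. \<ominus> g \<oplus> y0 \<oplus> g) ` carrier B"
  shows "\<exists>N::nat. 0 < N \<and> (\<forall>y\<in>Y. [N] \<cdot> y \<in> annihilator)"
proof -
  have y0B: "y0 \<in> carrier B" using y0 Y by auto
  have conjY: "\<ominus> g \<oplus> y \<oplus> g \<in> Y" if "g \<in> carrier B" "y \<in> Y" for g y
    using add.conjugacy_class_closed[OF y0B, folded cls] that .
  \<comment> \<open>Both actions are recorded only on \<open>Y\<close>, where they range over a finite set of maps.\<close>
  define F where "F = (\<lambda>k::nat. (restrict (\<lambda>y. \<ominus> ([k] \<cdot> y0) \<oplus> y \<oplus> [k] \<cdot> y0) Y,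
    restrict (lam ([k] \<cdot> y0)) Y))"
  have "range F \<subseteq> (Y \<rightarrow>\<^sub>E Y) \<times> (Y \<rightarrow>\<^sub>E Y)"
    using conjY lamY y0B by (auto simp: F_def)
  then have "finite (range F)" by (rule finite_subset) (intro finite_cartesian_product finite_PiE fin)
  then have "\<not> inj F" using finite_imageD by auto
  then obtain i j where ij: "i < j" "F i = F j" by (auto simp: inj_def) (metis linorder_neqE_nat)
  define N where "N = j - i"
  define z where "z = [N] \<cdot> y0"
  have N: "0 < N" "j = i + N" using ij by (auto simp: N_def)
  define u where "u = [i] \<cdot> y0"
  have zB: "z \<in> carrier B" and uB: "u \<in> carrier B" using y0B by (auto simp: z_def u_def)
  have juz: "[j] \<cdot> y0 = u \<oplus> z" "u \<oplus> z = z \<oplus> u"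
    using y0B N by (simp_all add: u_def z_def add.nat_pow_mult add.commute)
  have "z \<oplus> y = y \<oplus> z" if y: "y \<in> Y" for y
  proof -
    have yB: "y \<in> carrier B" using y Y by auto
    have "\<ominus> u \<oplus> y \<oplus> u = \<ominus> (z \<oplus> u) \<oplus> y \<oplus> (z \<oplus> u)"
      using fun_cong[OF arg_cong[OF ij(2), of fst], of y] y juz by (simp add: F_def u_def[symmetric])
    also have "\<dots> = \<ominus> u \<oplus> (\<ominus> z \<oplus> y \<oplus> z) \<oplus> u"
      using yB zB uB by (simp add: add.inv_mult_group add.m_assoc)
    finally have "y = \<ominus> z \<oplus> y \<oplus> z" using yB zB uB by simp
    then have "z \<oplus> y = z \<oplus> (\<ominus> z \<oplus> y \<oplus> z)" by simp
    then show ?thesis using yB zB by (simp add: add.m_assoc add.inv_cancel_left)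
  qed
  then have central: "z \<oplus> g = g \<oplus> z" if "g \<in> carrier B" for g
    using add.commutes_with_generated[OF zB Y] that gen unfolding add_span_def by blast
  \<comment> \<open>Multiples of conjugate elements are conjugate, and \<open>z\<close> is only conjugate to itself.\<close>
  have mult: "[N] \<cdot> y = z" if y: "y \<in> Y" for y
  proof -
    from y[unfolded cls] obtain g where g: "y = \<ominus> g \<oplus> y0 \<oplus> g" "g \<in> carrier B"
      by (rule imageE)
    have "[n] \<cdot> y = \<ominus> g \<oplus> [n] \<cdot> y0 \<oplus> g" for n :: nat
    proof (induction n)
      case 0
      then show ?case using g by simp
    next
      case (Suc n)
      have "\<ominus> g \<oplus> [n] \<cdot> y0 \<oplus> g \<oplus> (\<ominus> g \<oplus> y0 \<oplus> g) = \<ominus> g \<oplus> ([n] \<cdot> y0 \<oplus> y0) \<oplus> g"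
        using g y0B by (simp add: add.m_assoc add.inv_cancel_left)
      then show ?case using Suc g by simp
    qed
    then have "[N] \<cdot> y = \<ominus> g \<oplus> (z \<oplus> g)" using g zB by (simp add: z_def[symmetric] add.m_assoc)
    then show ?thesis unfolding central[OF g(2)] using g zB by (simp add: add.inv_cancel_left)
  qed
  have fixed: "lam g z = z" if g: "g \<in> carrier B" for g
    using lam_pow[OF g y0B] mult[OF lamY[OF g y0]] by (simp add: z_def)
  have "lam z y = y" if y: "y \<in> Y" for y
  proof -
    have yB: "y \<in> carrier B" using y Y by auto
    \<comment> \<open>As \<open>z\<close> is fixed by the lambda maps, adding it agrees with multiplying by it.\<close>
    have "lam u y = lam (u \<oplus> z) y"
      using fun_cong[OF arg_cong[OF ij(2), of snd], of y] y juz by (simp add: F_def u_def[symmetric])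
    also have "u \<oplus> z = u \<otimes> z" using circ_eq_add_lam[OF uB zB] fixed[OF uB] by simp
    also have "lam (u \<otimes> z) y = lam u (lam z y)" using uB zB yB by (rule lam_circ)
    finally have "lam (inv u) (lam u y) = lam (inv u) (lam u (lam z y))" by simp
    then show ?thesis using uB zB yB by (simp add: lam_inv_cancel)
  qed
  then have "lam z g = g" if "g \<in> carrier B" for g
    using lam_fixes_generated[OF zB Y] that gen by blast
  then have "z \<in> annihilator" using zB central fixed by (intro annihilatorI)
  then show ?thesis using mult N by auto
qed

theorem property_BS_if_generated_by_finite_class:
  assumes fin: "finite Y" and Y: "Y \<subseteq> carrier B"
    and gen: "add_span Y = carrier B"
    and lamY: "\<And>g y. g \<in> carrier B \<Longrightarrow> y \<in> Y \<Longrightarrow> lam g y \<in> Y"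
    and y0: "y0 \<in> Y" and cls: "Y = (\<lambda>g. \<ominus> g \<oplus> y0 \<oplus> g) ` carrier B"
  shows "property_BS B"
proof -
  obtain N :: nat where N: "0 < N" "\<forall>y\<in>Y. [N] \<cdot> y \<in> annihilator"
    using common_multiple_in_annihilator[OF fin Y gen lamY y0 cls] by blast
  have y0B: "y0 \<in> carrier B" using y0 Y by auto
  have conj: "\<ominus> y \<oplus> x \<oplus> y \<in> Y" if "x \<in> Y" "y \<in> Y" for x y
    using add.conjugacy_class_closed[OF y0B, folded cls] that Y by auto
  obtain W where "finite W" "W \<subseteq> carrier B" "\<forall>g\<in>carrier B. \<exists>k\<in>annihilator. \<exists>w\<in>W. g = k \<oplus> w"
    using add.finite_transversal_of_central_subgroup[OF annihilator_add_subgroup annihilatorD(2) fin Y conj gen[unfolded add_span_def] N(1)] N(2)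
    by blast
  then show ?thesis by (rule property_BS_if_annihilator_finite_index)
qed

end

section \<open>The structure skew brace\<close>

lemma presented_group_induct:
  assumes g: "g \<in> carrier (presented_group X R)"
    and one: "P \<one>\<^bsub>presented_group X R\<^esub>"
    and gen: "\<And>x g. x \<in> X \<Longrightarrow> g \<in> carrier (presented_group X R) \<Longrightarrow> P g \<Longrightarrow>
      P (word_rel X R `` {[(x, True)]} \<otimes>\<^bsub>presented_group X R\<^esub> g)"
    and inv: "\<And>x g. x \<in> X \<Longrightarrow> g \<in> carrier (presented_group X R) \<Longrightarrow> P g \<Longrightarrow>
      P (inv\<^bsub>presented_group X R\<^esub> (word_rel X R `` {[(x, True)]}) \<otimes>\<^bsub>presented_group X R\<^esub> g)"
  shows "P g"
proof -
  let ?G = "presented_group X R" and ?c = "\<lambda>w. word_rel X R `` {w}"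
  interpret group ?G by (rule group_presented_group)
  have car: "carrier ?G = ?c ` words X" and o: "\<one>\<^bsub>?G\<^esub> = ?c []"
    by (auto simp: presented_group_def quotient_def)
  have inv_gen: "?c [(x, False)] = inv\<^bsub>?G\<^esub> (?c [(x, True)])" if x: "x \<in> X" for x
  proof -
    have "word_eq X R [(x, False), (x, True)] []"
      using word_eq.cancel[of "[]" X "[]" x R False] x by simp
    then have "?c [(x, False), (x, True)] = ?c []"
      by (intro equiv_class_eq[OF equiv_word_rel]) (simp add: word_rel_def)
    then have "?c [(x, False)] \<otimes>\<^bsub>?G\<^esub> ?c [(x, True)] = \<one>\<^bsub>?G\<^esub>"
      using x by (simp add: presented_group_mult o)
    then show ?thesis using x unfolding car by (intro inv_equality[symmetric]) (auto simp: car)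
  qed
  have "P (?c w)" if "w \<in> words X" for w
    using that
  proof (induction w)
    case Nil
    then show ?case using one o by simp
  next
    case (Cons a w)
    obtain x b where a: "a = (x, b)" by (cases a)
    have x: "x \<in> X" and w: "w \<in> words X" using Cons a by auto
    have eq: "?c (a # w) = ?c [(x, b)] \<otimes>\<^bsub>?G\<^esub> ?c w"
      using presented_group_mult[of "[(x, b)]" X w R] x w a by simp
    have "?c w \<in> carrier ?G" using w car by auto
    then show ?case
      unfolding eq using Cons.IH gen[OF x] inv[OF x] inv_gen[OF x] by (cases b) auto
  qed
  then show ?thesis using g car by auto
qed

locale structure_skew_brace = skew_brace G for X :: "'a set" and r and G :: "'a word set ring" (structure) +
  assumes nondeg: "non_degenerate X r"
    and trunc: "monoid.truncate G = structure_group X r"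
    and r_iota: "\<And>x y. x \<in> X \<Longrightarrow> y \<in> X \<Longrightarrow>
      brace_r G (structure_iota X r x, structure_iota X r y) =
        map_prod (structure_iota X r) (structure_iota X r) (r (x, y))"
begin

abbreviation "\<iota> \<equiv> structure_iota X r"

lemma sigma_bij: "x \<in> X \<Longrightarrow> bij_betw (sol_sigma r x) X X"
  and tau_bij: "x \<in> X \<Longrightarrow> bij_betw (sol_tau r x) X X"
  using nondeg by (auto simp: non_degenerate_def)

lemma sigma_closed: "x \<in> X \<Longrightarrow> y \<in> X \<Longrightarrow> sol_sigma r x y \<in> X"
  and tau_closed: "x \<in> X \<Longrightarrow> y \<in> X \<Longrightarrow> sol_tau r y x \<in> X"
  using sigma_bij[of x] tau_bij[of y] bij_betwE by blast+

lemma structure_group_simps: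
  "carrier (structure_group X r) = carrier G"
  "mult (structure_group X r) = mult G"
  "one (structure_group X r) = one G"
  "m_inv (structure_group X r) = m_inv G"
  unfolding trunc[symmetric] by (auto simp: monoid.defs m_inv_def)

lemma iota_closed [simp]: "x \<in> X \<Longrightarrow> \<iota> x \<in> carrier G"
  unfolding structure_group_simps(1)[symmetric]
  by (auto simp: structure_iota_def structure_group_def presented_group_def quotient_def)

lemma circ_generated_induct [consumes 1, case_names one gen inv]:
  assumes "g \<in> carrier G" "P \<one>"
    and "\<And>x g. x \<in> X \<Longrightarrow> g \<in> carrier G \<Longrightarrow> P g \<Longrightarrow> P (\<iota> x \<otimes> g)"
    and "\<And>x g. x \<in> X \<Longrightarrow> g \<in> carrier G \<Longrightarrow> P g \<Longrightarrow> P (inv (\<iota> x) \<otimes> g)"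
  shows "P g"
  using presented_group_induct[of g X "structure_relations X r" P] assms
  unfolding structure_group_def[symmetric] structure_group_simps structure_iota_def[symmetric]
  by blast

lemma lam_iota: "x \<in> X \<Longrightarrow> y \<in> X \<Longrightarrow> lam (\<iota> x) (\<iota> y) = \<iota> (sol_sigma r x y)"
  using r_iota[of x y] by (cases "r (x, y)") (auto simp: brace_r_def sol_sigma_def)

lemma circ_iota:
  assumes "x \<in> X" "y \<in> X"
  shows "\<iota> x \<otimes> \<iota> y = \<iota> (sol_sigma r x y) \<otimes> \<iota> (sol_tau r y x)"
proof -
  have "inv (\<iota> (sol_sigma r x y)) \<otimes> \<iota> x \<otimes> \<iota> y = \<iota> (sol_tau r y x)"
    using r_iota[OF assms] lam_iota[OF assms]
    by (cases "r (x, y)") (auto simp: brace_r_def sol_tau_def)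
  then have "\<iota> (sol_sigma r x y) \<otimes> \<iota> (sol_tau r y x) =
      \<iota> (sol_sigma r x y) \<otimes> (inv (\<iota> (sol_sigma r x y)) \<otimes> \<iota> x \<otimes> \<iota> y)" by simp
  then show ?thesis using assms sigma_closed[OF assms] by (simp add: m_assoc inv_cancel_left)
qed

lemma derived_eta_closed:
  assumes "x \<in> X" "y \<in> X"
  shows "derived_eta X r y x \<in> X"
proof -
  have "inv_into X (sol_sigma r x) y \<in> X"
    using sigma_bij[OF assms(1)] assms by (intro inv_into_into) (auto simp: bij_betw_def)
  then show ?thesis using assms by (simp add: derived_eta_def sigma_closed tau_closed)
qed

text \<open>With \<open>u = \<sigma>\<^sub>x\<^sup>-\<^sup>1(y)\<close> the defining relation \<open>x u = y \<tau>\<^sub>u(x)\<close> becomes, after writing both products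
  additively, \<open>x + y = y + \<sigma>\<^sub>y(\<tau>\<^sub>u(x))\<close>; the last summand is \<open>\<eta>\<^sub>y(x)\<close>.\<close>

lemma conj_iota:
  assumes "x \<in> X" "y \<in> X"
  shows "\<ominus> \<iota> y \<oplus> \<iota> x \<oplus> \<iota> y = \<iota> (derived_eta X r y x)"
proof -
  define u where "u = inv_into X (sol_sigma r x) y"
  have u: "u \<in> X" "sol_sigma r x u = y"
    using sigma_bij[OF assms(1)] assms(2) unfolding u_def bij_betw_def
    by (metis inv_into_into, metis f_inv_into_f)
  have t: "sol_tau r u x \<in> X" using u assms by (simp add: tau_closed)
  have "\<iota> x \<oplus> \<iota> y = \<iota> x \<otimes> \<iota> u"
    using u assms by (simp add: circ_eq_add_lam lam_iota)
  also have "\<dots> = \<iota> y \<otimes> \<iota> (sol_tau r u x)" using circ_iota[OF assms(1) u(1)] u(2) by simp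
  also have "\<dots> = \<iota> y \<oplus> \<iota> (derived_eta X r y x)"
    using assms t by (simp add: circ_eq_add_lam lam_iota derived_eta_def u_def[symmetric])
  finally show ?thesis using assms derived_eta_closed[OF assms]
    by (simp add: add.m_assoc add.inv_cancel_left)
qed

lemma lam_generator_image:
  assumes "x \<in> X"
  shows "lam (\<iota> x) ` \<iota> ` X = \<iota> ` X"
proof -
  have "lam (\<iota> x) ` \<iota> ` X = \<iota> ` sol_sigma r x ` X"
    unfolding image_image using assms by (intro image_cong) (simp_all add: lam_iota)
  then show ?thesis using sigma_bij[OF assms] by (simp add: bij_betw_def)
qed

lemma lam_image_iota:
  assumes "g \<in> carrier G"
  shows "lam g ` \<iota> ` X = \<iota> ` X"
  using assms
proof (induction rule: circ_generated_induct)
  case one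
  show ?case by (simp add: lam_one image_image)
next
  case (gen x g)
  have "lam (\<iota> x \<otimes> g) ` \<iota> ` X = lam (\<iota> x) ` lam g ` \<iota> ` X"
    unfolding image_image using gen by (intro image_cong) (simp_all add: lam_circ)
  then show ?case using gen by (simp add: lam_generator_image)
next
  case (inv x g)
  have "lam (inv (\<iota> x)) ` lam (\<iota> x) ` \<iota> ` X = \<iota> ` X"
    unfolding image_image using inv by (intro image_cong) (simp_all add: lam_inv_cancel)
  then have "lam (inv (\<iota> x)) ` \<iota> ` X = \<iota> ` X" using inv by (simp add: lam_generator_image)
  moreover have "lam (inv (\<iota> x) \<otimes> g) ` \<iota> ` X = lam (inv (\<iota> x)) ` lam g ` \<iota> ` X"
    unfolding image_image using inv by (intro image_cong) (simp_all add: lam_circ)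
  ultimately show ?case using inv by simp
qed

lemma iota_image_closed: "\<iota> ` X \<subseteq> carrier G"
  by auto

text \<open>The additive subgroup generated by a \<open>\<lambda>\<close>-invariant set is \<open>\<lambda>\<close>-invariant, hence closed under
  \<open>a \<otimes> b = a \<oplus> \<lambda>\<^sub>a(b)\<close>, and it contains the multiplicative inverse \<open>\<lambda>\<^sub>y(\<ominus> x)\<close>, \<open>y = inv x\<close>, of each
  generator \<open>x\<close>. So it is all of \<open>G\<close>.\<close>

lemma add_span_iota: "add_span (\<iota> ` X) = carrier G"
proof
  let ?K = "add_span (\<iota> ` X)"
  show sub: "?K \<subseteq> carrier G" by (rule add_span_subset[OF iota_image_closed])
  have lamK: "lam g k \<in> ?K" if g: "g \<in> carrier G" and k: "k \<in> ?K" for g k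
    using k
  proof (induction k rule: add_span_induct)
    case zero
    then show ?case using g by (simp add: lam_zero add_span_closed)
  next
    case (incl h)
    then have "lam g h \<in> lam g ` \<iota> ` X" by (rule imageI)
    then show ?case unfolding lam_image_iota[OF g] by (rule add_span_closed(2))
  next
    case (neg h)
    then have "lam g h \<in> lam g ` \<iota> ` X" by (intro imageI)
    then have "\<ominus> lam g h \<in> ?K" unfolding lam_image_iota[OF g] by (rule add_span_closed(3))
    moreover have "h \<in> carrier G" using neg by auto
    ultimately show ?case using g by (simp add: lam_neg)
  next
    case (add h k)
    then show ?case using g sub add_span_closed(4) by (simp add: lam_add subset_iff)
  qed
  have circK: "h \<otimes> k \<in> ?K" if "h \<in> ?K" "k \<in> ?K" for h k
    using that sub lamK[of h k] add_span_closed(4)[of h _ "lam h k"]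
    by (simp add: circ_eq_add_lam subset_iff)
  show "carrier G \<subseteq> ?K"
  proof
    fix g assume "g \<in> carrier G"
    then show "g \<in> ?K"
    proof (induction rule: circ_generated_induct)
      case one
      show ?case using add_span_closed(1) zero_eq_one by simp
    next
      case (gen x g)
      then show ?case using circK add_span_closed(2) by simp
    next
      case (inv x g)
      let ?y = "inv (\<iota> x)"
      have "?y \<oplus> lam ?y (\<iota> x) = \<zero>"
        using inv by (simp add: circ_eq_add_lam[symmetric] zero_eq_one)
      from add.inv_equality[OF this] have "?y = \<ominus> lam ?y (\<iota> x)" using inv by simp
      also have "\<dots> = lam ?y (\<ominus> \<iota> x)" using inv by (simp add: lam_neg)
      finally have "?y \<in> ?K" using lamK[of ?y "\<ominus> \<iota> x"] add_span_closed(3) inv by simp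
      then show ?case using inv by (intro circK)
    qed
  qed
qed

text \<open>The points of \<open>X\<close> mapped into the class of \<open>\<iota> x0\<close> and the remaining points are both closed
  under the derived solution, since \<open>\<eta>\<close> acts by conjugation; indecomposability leaves no remaining
  points.\<close>

lemma iota_image_conj_class:
  assumes fin: "finite X" and indec: "derived_indecomposable X r" and x0: "x0 \<in> X"
  shows "\<iota> ` X = (\<lambda>g. \<ominus> g \<oplus> \<iota> x0 \<oplus> g) ` carrier G" (is "_ = ?C")
proof
  have conj: "\<ominus> y \<oplus> x \<oplus> y \<in> \<iota> ` X" if "x \<in> \<iota> ` X" "y \<in> \<iota> ` X" for x y
    using that conj_iota derived_eta_closed by auto
  show C: "?C \<subseteq> \<iota> ` X"
    using add.conjugation_closed_under_generated[OF finite_imageI[OF fin] iota_image_closed conj]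
      add_span_iota[unfolded add_span_def] x0 by auto
  have conjC: "\<ominus> g \<oplus> c \<oplus> g \<in> ?C \<longleftrightarrow> c \<in> ?C" if g: "g \<in> carrier G" and c: "c \<in> carrier G" for g c
  proof
    note * = add.conjugacy_class_closed[OF iota_closed[OF x0]]
    show "\<ominus> g \<oplus> c \<oplus> g \<in> ?C" if "c \<in> ?C" using *[OF g that] .
    assume "\<ominus> g \<oplus> c \<oplus> g \<in> ?C"
    then have "\<ominus> (\<ominus> g) \<oplus> (\<ominus> g \<oplus> c \<oplus> g) \<oplus> \<ominus> g \<in> ?C" by (rule *[OF add.inv_closed[OF g]])
    moreover have "\<ominus> (\<ominus> g) \<oplus> (\<ominus> g \<oplus> c \<oplus> g) \<oplus> \<ominus> g = c"
      using g c by (simp add: add.m_assoc add.inv_cancel_left)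
    ultimately show "c \<in> ?C" by simp
  qed
  define C where "C = ?C"
  let ?X1 = "{x \<in> X. \<iota> x \<in> C}" and ?X2 = "{x \<in> X. \<iota> x \<notin> C}"
  have eta: "\<iota> (derived_eta X r y x) \<in> C \<longleftrightarrow> \<iota> x \<in> C" if "x \<in> X" "y \<in> X" for x y
    using conjC[of "\<iota> y" "\<iota> x"] conj_iota that unfolding C_def by simp
  have "?X2 = {}"
  proof (rule ccontr)
    assume ne: "?X2 \<noteq> {}"
    have "\<iota> x0 \<in> C" unfolding C_def using x0 by (intro image_eqI[of _ _ \<zero>]) auto
    then have "?X1 \<noteq> {}" using x0 by blast
    moreover have "derived_solution X r ` (?X1 \<times> ?X1) \<subseteq> ?X1 \<times> ?X1"
      "derived_solution X r ` (?X2 \<times> ?X2) \<subseteq> ?X2 \<times> ?X2"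
      using eta derived_eta_closed by (auto simp: derived_solution_def)
    moreover have "?X1 \<inter> ?X2 = {}" "?X1 \<union> ?X2 = X" by blast+
    ultimately have "decomposable X (derived_solution X r)"
      using ne unfolding decomposable_def by (intro exI[of _ ?X1] exI[of _ ?X2] conjI)
    then show False using indec by (simp add: derived_indecomposable_def indecomposable_def)
  qed
  then show "\<iota> ` X \<subseteq> ?C" unfolding C_def[symmetric] by blast
qed

theorem property_BS_if_derived_indecomposable:
  assumes fin: "finite X" and ne: "X \<noteq> {}" and indec: "derived_indecomposable X r"
  shows "property_BS G"
proof -
  obtain x0 where x0: "x0 \<in> X" using ne by blast
  show ?thesis
  proof (rule property_BS_if_generated_by_finite_class)
    show "lam g y \<in> \<iota> ` X" if "g \<in> carrier G" "y \<in> \<iota> ` X" for g y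
      using imageI[OF that(2), of "lam g"] unfolding lam_image_iota[OF that(1)] .
    show "\<iota> ` X = (\<lambda>g. \<ominus> g \<oplus> \<iota> x0 \<oplus> g) ` carrier G"
      using fin indec x0 by (rule iota_image_conj_class)
  qed (use fin x0 iota_image_closed add_span_iota in auto)
qed

end

theorem theorem4p5:
  fixes X :: "'a set" and r :: "'a \<times> 'a \<Rightarrow> 'a \<times> 'a" and G :: "'a word set ring"
  assumes "ybe_solution X r"
    and "non_degenerate X r"
    and "finite X"
    and "derived_indecomposable X r"
    and "is_structure_skew_brace X r G"
  shows "property_BS G"
proof -
  interpret structure_skew_brace X r G
    using assms(2,5)
    by (auto simp: is_structure_skew_brace_def structure_skew_brace_def structure_skew_brace_axioms_def)
  have "X \<noteq> {}" using assms(1) by (simp add: ybe_solution_def)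
  then show ?thesis using assms(3,4) by (intro property_BS_if_derived_indecomposable)
qed

end
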